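(* Let $s,t,a$ be integers with $2\le a\le s\le t$ and $a(s+t-a-2)\ge 1$. Then for every positive integer $n$, $$r\!\left(K_{n,n},K_{s,t},\,st-a(s+t-a-2)+1\right)\ge \left(\frac{n}{t-1}\right)^{1/a}.$$
   Context: For graphs $G,H$ and an integer $q$ with $2\le q\le |E(H)|$, an $(H,q)$-coloring of $G$ is an edge-coloring of $G$ in which every subgraph of $G$ isomorphic to $H$ receives at least $q$ distinct colors; $r(G,H,q)$ is the minimum number of colors needed for $G$ to have an $(H,q)$-coloring. $K_{n,n}$, $K_{s,t}$ denote complete bipartite graphs. *)

theory Defs
  imports "HOL-Analysis.Analysis"
begin

text \<open>
  Graphs are finite simple undirected graphs, given by a vertex set and a set of two-element
  subsets of it. (The symmetric digraphs of the AFP entry \<open>Graph_Theory\<close> carry two arcs per edge,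
  which is awkward for counting colours of undirected edges.)
\<close>

type_synonym 'v graph = "'v set \<times> 'v set set"

abbreviation verts :: "'v graph \<Rightarrow> 'v set" where "verts G \<equiv> fst G"
abbreviation edges :: "'v graph \<Rightarrow> 'v set set" where "edges G \<equiv> snd G"

definition is_graph :: "'v graph \<Rightarrow> bool" where
  "is_graph G \<longleftrightarrow> finite (verts G) \<and> (\<forall>e\<in>edges G. e \<subseteq> verts G \<and> card e = 2)"

definition subgraph :: "'v graph \<Rightarrow> 'v graph \<Rightarrow> bool" where
  "subgraph F G \<longleftrightarrow> is_graph F \<and> verts F \<subseteq> verts G \<and> edges F \<subseteq> edges G"

definition isomorphic :: "'v graph \<Rightarrow> 'w graph \<Rightarrow> bool" where
  "isomorphic F H \<longleftrightarrow>
     (\<exists>f. bij_betw f (verts F) (verts H) \<and> edges H = (\<lambda>e. f ` e) ` edges F)"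

definition complete_bipartite :: "nat \<Rightarrow> nat \<Rightarrow> (nat + nat) graph" where
  "complete_bipartite m n =
     (Inl ` {..<m} \<union> Inr ` {..<n}, {{Inl i, Inr j} | i j. i < m \<and> j < n})"

definition Hq_coloring :: "'w graph \<Rightarrow> nat \<Rightarrow> 'v graph \<Rightarrow> ('v set \<Rightarrow> 'c) \<Rightarrow> bool" where
  "Hq_coloring H q G c \<longleftrightarrow>
     (\<forall>F. subgraph F G \<and> isomorphic F H \<longrightarrow> q \<le> card (c ` edges F))"

text \<open>The least element exists when \<^term>\<open>q \<le> card (edges H)\<close>; see \<open>min_colors_attained\<close>.\<close>

definition min_colors :: "'v graph \<Rightarrow> 'w graph \<Rightarrow> nat \<Rightarrow> nat" where
  "min_colors G H q =
     (LEAST k. \<exists>c :: 'v set \<Rightarrow> nat. c ` edges G \<subseteq> {..<k} \<and> Hq_coloring H q G c)"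

lemma finite_edges: "is_graph G \<Longrightarrow> finite (edges G)"
  unfolding is_graph_def by (rule finite_subset[of _ "Pow (verts G)"]) auto

lemma isomorphic_card_edges:
  assumes "is_graph F" "isomorphic F H"
  shows "card (edges H) = card (edges F)"
proof -
  obtain f where f: "bij_betw f (verts F) (verts H)" "edges H = (\<lambda>e. f ` e) ` edges F"
    using assms(2) unfolding isomorphic_def by blast
  have "inj_on f (verts F)" using f(1) by (rule bij_betw_imp_inj_on)
  moreover have "edges F \<subseteq> Pow (verts F)" using assms(1) unfolding is_graph_def by auto
  ultimately have "inj_on (\<lambda>e. f ` e) (edges F)"
    by (meson inj_on_image_Pow inj_on_subset)
  then show ?thesis unfolding f(2) by (rule card_image)
qed

lemma min_colors_attained:
  fixes G :: "'v graph" and H :: "'w graph"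
  assumes "is_graph G" "q \<le> card (edges H)"
  shows "\<exists>c :: 'v set \<Rightarrow> nat. c ` edges G \<subseteq> {..<min_colors G H q} \<and> Hq_coloring H q G c"
proof -
  obtain c where c: "bij_betw c (edges G) {0..<card (edges G)}"
    using ex_bij_betw_finite_nat[OF finite_edges[OF assms(1)]] by blast
  have inj: "inj_on c (edges G)" using c by (rule bij_betw_imp_inj_on)
  have "q \<le> card (c ` edges F)" if "subgraph F G" "isomorphic F H" for F
  proof -
    have "inj_on c (edges F)" using inj that(1) inj_on_subset unfolding subgraph_def by blast
    then show ?thesis
      using isomorphic_card_edges[OF _ that(2)] that(1) assms(2)
      by (simp add: card_image subgraph_def)
  qed
  then have "Hq_coloring H q G c" unfolding Hq_coloring_def by blast
  moreover have "c ` edges G \<subseteq> {..<card (edges G)}" using c unfolding bij_betw_def by auto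
  ultimately have "\<exists>k. \<exists>c :: 'v set \<Rightarrow> nat. c ` edges G \<subseteq> {..<k} \<and> Hq_coloring H q G c"
    by blast
  then show ?thesis unfolding min_colors_def by (rule LeastI_ex)
qed

lemma is_graph_complete_bipartite: "is_graph (complete_bipartite m n)"
  unfolding is_graph_def complete_bipartite_def by auto

lemma card_edges_complete_bipartite: "card (edges (complete_bipartite m n)) = m * n"
proof -
  have "edges (complete_bipartite m n) =
      (\<lambda>(i, j). {Inl i, Inr j}) ` ({..<m} \<times> {..<n})"
    unfolding complete_bipartite_def by auto
  moreover have "inj_on (\<lambda>(i, j). {Inl i, Inr j} :: (nat + nat) set) ({..<m} \<times> {..<n})"
    by (auto simp: inj_on_def doubleton_eq_iff)
  ultimately show ?thesis by (simp add: card_image card_cartesian_product)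
qed

text \<open>No truncated subtraction on \<^typ>\<open>nat\<close> occurs for the parameters considered, and the
  resulting number of colours lies in the admissible range.\<close>

lemma color_number_admissible:
  fixes s t a :: nat
  assumes "2 \<le> a" "a \<le> s" "s \<le> t" "a * (s + t - a - 2) \<ge> 1"
  defines "q \<equiv> s * t - a * (s + t - a - 2) + 1"
  shows "int q = int s * int t - int a * (int s + int t - int a - 2) + 1"
    and "2 \<le> q" and "q \<le> card (edges (complete_bipartite s t))"
proof -
  have b: "int (a * (s + t - a - 2)) = int a * (int s + int t - int a - 2)"
    using assms(1-3) by (simp add: of_nat_diff)
  have "0 \<le> (int s - int a) * (int t - int a)" using assms(2,3) by simp
  then have "int a * (int s + int t - int a - 2) + 2 * int a \<le> int s * int t"
    by (simp add: algebra_simps)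
  then have "int (a * (s + t - a - 2) + 2 * a) \<le> int (s * t)"
    unfolding of_nat_add b by simp
  then have le: "a * (s + t - a - 2) + 2 * a \<le> s * t" by (simp only: of_nat_le_iff)
  then show "int q = int s * int t - int a * (int s + int t - int a - 2) + 1"
    unfolding q_def of_nat_add b[symmetric] by (simp add: of_nat_diff del: of_nat_mult, simp)
  show "2 \<le> q" unfolding q_def using le assms(1) by linarith
  show "q \<le> card (edges (complete_bipartite s t))"
    unfolding q_def card_edges_complete_bipartite using le assms(1,4) by linarith
qed

end

theory Submission
  imports Defs
begin

text \<open>
  Suppose \<open>r\<close> colours suffice and \<open>n > (t - 1) r\<^sup>a\<close>. Fix a set \<open>X\<close> of \<open>a\<close> left vertices. By the
  pigeonhole principle some \<open>t\<close> right vertices have the same vector of colours towards \<open>X\<close>; call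
  this set \<open>T\<close> and choose \<open>Y \<subseteq> T\<close> with \<open>a\<close> elements. The pigeonhole principle also gives a set \<open>Z\<close>
  of \<open>s - a\<close> further left vertices having the same vector of colours towards \<open>Y\<close>. The copy of
  \<open>K\<^sub>s\<^sub>,\<^sub>t\<close> on \<open>X \<union> Z\<close> and \<open>T\<close> has at most \<open>a\<close> colours between \<open>X\<close> and \<open>T\<close>, at most \<open>a\<close> between \<open>Z\<close>
  and \<open>Y\<close>, and at most \<open>(s - a) (t - a)\<close> on the remaining edges, one colour too few.
\<close>

lemma pigeonhole_constant_subset:
  assumes "finite C" "f ` B \<subseteq> C" "k * card C < card B"
  obtains T where "T \<subseteq> B" "card T = Suc k" "\<And>x y. x \<in> T \<Longrightarrow> y \<in> T \<Longrightarrow> f x = f y"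
proof -
  have "\<exists>v\<in>C. k < card {x \<in> B. f x = v}"
  proof (rule ccontr)
    assume "\<not> ?thesis"
    then have small: "card {x \<in> B. f x = v} \<le> k" if "v \<in> C" for v
      using that by (auto simp: not_less)
    have "B = (\<Union>v\<in>C. {x \<in> B. f x = v})"
      using assms(2) by auto
    then have "card B \<le> (\<Sum>v\<in>C. card {x \<in> B. f x = v})"
      using card_UN_le[OF assms(1), of "\<lambda>v. {x \<in> B. f x = v}"] by simp
    also have "\<dots> \<le> (\<Sum>v\<in>C. k)"
      by (rule sum_mono) (rule small)
    finally show False
      using assms(3) by (simp add: mult.commute)
  qed
  then obtain v where "Suc k \<le> card {x \<in> B. f x = v}"
    by (auto simp: Suc_le_eq)
  then obtain T where "T \<subseteq> {x \<in> B. f x = v}" "card T = Suc k"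
    by (meson obtain_subset_with_card_n)
  then show ?thesis
    by (intro that[of T]) auto
qed

text \<open>Each \<open>y\<close> determines a vector of values indexed by \<open>X\<close>, and
  there are at most \<open>r ^ card X\<close> such vectors. The guard \<open>0 < k\<close> admits
  \<open>k = 0\<close> even for empty \<open>B\<close>, as can happen below when
  \<open>s = a\<close>.\<close>

lemma pigeonhole_constant_vectors:
  fixes d :: "'a \<Rightarrow> 'b \<Rightarrow> nat"
  assumes "finite X" "\<And>x y. x \<in> X \<Longrightarrow> y \<in> B \<Longrightarrow> d x y < r"
    and "0 < k \<Longrightarrow> (k - 1) * r ^ card X < card B"
  obtains T where "T \<subseteq> B" "card T = k"
    "\<And>x y y'. x \<in> X \<Longrightarrow> y \<in> T \<Longrightarrow> y' \<in> T \<Longrightarrow> d x y = d x y'"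
proof (cases k)
  case 0
  show ?thesis by (rule that[of "{}"]) (simp_all add: 0)
next
  case (Suc m)
  \<comment> \<open>\<open>restrict\<close> makes the vectors extensional, so that they lie in a
    finite function space of known size.\<close>
  define f where "f y = restrict (\<lambda>x. d x y) X" for y
  have "f ` B \<subseteq> X \<rightarrow>\<^sub>E {..<r}"
    using assms(2) by (auto simp: f_def)
  moreover have "finite (X \<rightarrow>\<^sub>E {..<r})"
    using assms(1) by (simp add: finite_PiE)
  moreover have "m * card (X \<rightarrow>\<^sub>E {..<r}) < card B"
    using assms(1,3) by (simp add: card_PiE Suc)
  ultimately obtain T where T: "T \<subseteq> B" "card T = Suc m"
    and const: "\<And>y y'. y \<in> T \<Longrightarrow> y' \<in> T \<Longrightarrow> f y = f y'"
    by (metis pigeonhole_constant_subset)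
  have "d x y = d x y'" if "x \<in> X" "y \<in> T" "y' \<in> T" for x y y'
    using fun_cong[OF const[OF that(2,3)], of x] that(1) by (simp add: f_def)
  with T(1) T(2)[folded Suc] show ?thesis
    by (rule that)
qed

text \<open>Enumerations of \<open>S\<close> and \<open>T\<close> by initial segments combine, via
  \<open>map_sum\<close>, into an isomorphism that respects the two sides.\<close>

lemma complete_bipartite_copy:
  assumes "S \<subseteq> {..<m}" "T \<subseteq> {..<n}"
  defines "F \<equiv> (Inl ` S \<union> Inr ` T, {{Inl i, Inr j} | i j. i \<in> S \<and> j \<in> T})"
  shows "subgraph F (complete_bipartite m n)"
    and "isomorphic F (complete_bipartite (card S) (card T))"
proof -
  have fin: "finite S" "finite T"
    using assms(1,2) finite_subset by blast+
  show "subgraph F (complete_bipartite m n)"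
    unfolding subgraph_def is_graph_def F_def complete_bipartite_def
    using assms(1,2) fin by auto
  obtain g h where g: "bij_betw g S {..<card S}" and h: "bij_betw h T {..<card T}"
    using fin ex_bij_betw_finite_nat by (metis atLeast0LessThan)
  have img: "g ` S = {..<card S}" "h ` T = {..<card T}"
    using g h by (simp_all add: bij_betw_def)
  have inj: "inj_on g S" "inj_on h T"
    using g h by (simp_all add: bij_betw_def)
  show "isomorphic F (complete_bipartite (card S) (card T))"
    unfolding isomorphic_def
  proof (intro exI conjI)
    have "inj_on (map_sum g h) (Inl ` S \<union> Inr ` T)"
      by (rule inj_onI) (auto dest: inj_onD[OF inj(1)] inj_onD[OF inj(2)])
    moreover have "map_sum g h ` (Inl ` S \<union> Inr ` T) = Inl ` g ` S \<union> Inr ` h ` T"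
      by (simp add: image_Un image_image)
    ultimately show
      "bij_betw (map_sum g h) (verts F) (verts (complete_bipartite (card S) (card T)))"
      unfolding bij_betw_def F_def complete_bipartite_def by (simp add: img)
    have F: "edges F = (\<lambda>(i, j). {Inl i, Inr j}) ` (S \<times> T)"
      unfolding F_def by auto
    have "edges (complete_bipartite (card S) (card T)) =
        (\<lambda>(u, v). {Inl u, Inr v}) ` (g ` S \<times> h ` T)"
      unfolding img complete_bipartite_def by auto
    also have "g ` S \<times> h ` T = map_prod g h ` (S \<times> T)"
      by (rule map_prod_surj_on[OF refl refl, symmetric])
    also have "(\<lambda>(u, v). {Inl u, Inr v}) ` \<dots> = (\<lambda>e. map_sum g h ` e) ` edges F"
      unfolding F by (simp add: image_image case_prod_unfold)
    finally show "edges (complete_bipartite (card S) (card T)) =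
        (\<lambda>e. map_sum g h ` e) ` edges F" .
  qed
qed

lemma Hq_coloring_complete_bipartiteD:
  assumes "Hq_coloring (complete_bipartite (card S) (card T)) q (complete_bipartite m n) c"
    and "S \<subseteq> {..<m}" "T \<subseteq> {..<n}"
  shows "q \<le> card ((\<lambda>(i, j). c {Inl i, Inr j}) ` (S \<times> T))"
proof -
  let ?F = "(Inl ` S \<union> Inr ` T, {{Inl i, Inr j} | i j. i \<in> S \<and> j \<in> T})"
  have "q \<le> card (c ` edges ?F)"
    using assms(1) conjI[OF complete_bipartite_copy[OF assms(2,3)]]
    unfolding Hq_coloring_def by (elim allE[of _ ?F]) (erule mp)
  also have "c ` edges ?F = (\<lambda>(i, j). c {Inl i, Inr j}) ` (S \<times> T)"
    by auto
  finally show ?thesis .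
qed

text \<open>Each row in \<open>X\<close> and each column in \<open>Y\<close>, restricted to
  \<open>Z\<close>, contributes at most one colour. The remaining block
  \<open>Z \<times> (T - Y)\<close> contributes at most one colour per cell.\<close>

lemma card_image_constant_strips:
  fixes d :: "'a \<Rightarrow> 'b \<Rightarrow> 'c"
  assumes "finite X" "finite Z" "finite T" "Y \<subseteq> T"
    and row: "\<And>x y y'. x \<in> X \<Longrightarrow> y \<in> T \<Longrightarrow> y' \<in> T \<Longrightarrow> d x y = d x y'"
    and col: "\<And>y z z'. y \<in> Y \<Longrightarrow> z \<in> Z \<Longrightarrow> z' \<in> Z \<Longrightarrow> d z y = d z' y"
  shows "card ((\<lambda>(x, y). d x y) ` ((X \<union> Z) \<times> T)) \<le> card X + card Y + card Z * (card T - card Y)"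
proof -
  have finY: "finite Y"
    using assms(3,4) finite_subset by blast
  \<comment> \<open>Representatives are chosen by \<open>SOME\<close> because \<open>T\<close> or
    \<open>Z\<close> may be empty; they are used only once a member is known.\<close>
  define y0 where "y0 = (SOME y. y \<in> T)"
  define z0 where "z0 = (SOME z. z \<in> Z)"
  have y0: "y0 \<in> T" if "y \<in> T" for y
    using that unfolding y0_def by (rule someI)
  have z0: "z0 \<in> Z" if "z \<in> Z" for z
    using that unfolding z0_def by (rule someI)
  let ?A = "(\<lambda>x. d x y0) ` X" and ?B = "(\<lambda>y. d z0 y) ` Y"
    and ?C = "(\<lambda>(x, y). d x y) ` (Z \<times> (T - Y))"
  have "d x y \<in> ?A \<union> ?B \<union> ?C" if "x \<in> X \<union> Z" "y \<in> T" for x y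
  proof -
    consider "x \<in> X" | "x \<in> Z" "y \<in> Y" | "x \<in> Z" "y \<in> T - Y"
      using \<open>x \<in> X \<union> Z\<close> \<open>y \<in> T\<close> by blast
    then show ?thesis
    proof cases
      case 1
      then have "d x y = d x y0"
        using row \<open>y \<in> T\<close> y0 by blast
      with 1 show ?thesis by auto
    next
      case 2
      then have "d x y = d z0 y"
        using col z0 by blast
      with 2 show ?thesis by auto
    next
      case 3
      then show ?thesis by auto
    qed
  qed
  then have "(\<lambda>(x, y). d x y) ` ((X \<union> Z) \<times> T) \<subseteq> ?A \<union> ?B \<union> ?C"
    by auto
  then have "card ((\<lambda>(x, y). d x y) ` ((X \<union> Z) \<times> T)) \<le> card (?A \<union> ?B \<union> ?C)"
    using assms(1-3) finY by (intro card_mono) auto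
  also have "\<dots> \<le> card ?A + card ?B + card ?C"
    by (meson add_le_mono1 card_Un_le le_trans)
  also have "\<dots> \<le> card X + card Y + card (Z \<times> (T - Y))"
    using assms(1-3) finY by (intro add_mono card_image_le) auto
  finally show ?thesis
    using assms(4) finY by (simp add: card_cartesian_product card_Diff_subset)
qed

text \<open>The left side of \<open>many\<close> is the largest number of colours that the
  constructed copy can show.\<close>

lemma Hq_coloring_complete_bipartite_bound:
  fixes s t a n r :: nat
  assumes "a \<le> s" "s \<le> t" "1 \<le> n"
    and bound: "c ` edges (complete_bipartite n n) \<subseteq> {..<r}"
    and coloring: "Hq_coloring (complete_bipartite s t) q (complete_bipartite n n) c"
    and many: "2 * a + (s - a) * (t - a) < q"
  shows "n \<le> (t - 1) * r ^ a"
proof (rule ccontr)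
  assume "\<not> ?thesis"
  then have big: "(t - 1) * r ^ a < n" by simp
  define d where "d i j = c {Inl i, Inr j}" for i j
  have d: "d i j < r" if "i < n" "j < n" for i j
    using bound that unfolding d_def complete_bipartite_def by (auto simp: image_subset_iff)
  \<comment> \<open>As \<open>n\<close> is positive there is an edge, which needs a colour, so
    \<open>r > 0\<close>.\<close>
  have "r ^ a \<ge> 1"
    using d[of 0 0] \<open>1 \<le> n\<close> by simp
  then have "t - 1 < n"
    using big by (metis le_less_trans mult.right_neutral mult_le_mono2)
  then have "a \<le> n"
    using assms(1,2) by simp
  define X where "X = {..<a}"
  have X: "finite X" "card X = a" "X \<subseteq> {..<n}"
    using \<open>a \<le> n\<close> by (auto simp: X_def)
  obtain T where T: "T \<subseteq> {..<n}" "card T = t"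
    and row: "\<And>x y y'. x \<in> X \<Longrightarrow> y \<in> T \<Longrightarrow> y' \<in> T \<Longrightarrow> d x y = d x y'"
    using pigeonhole_constant_vectors[of X "{..<n}" d r t] big X d by (auto simp: subset_iff)
  then have "finite T"
    using finite_subset by blast
  obtain Y where Y: "Y \<subseteq> T" "card Y = a" "finite Y"
    using obtain_subset_with_card_n[of a T] T(2) assms(1,2) by auto
  \<comment> \<open>Removing \<open>X\<close> costs \<open>a \<le> a * r ^ a\<close> vertices. Since
    \<open>(s - a - 1) + a = s - 1 \<le> t - 1\<close>, the assumed size of \<open>n\<close> still
    suffices.\<close>
  have "(s - a - 1) * r ^ a < card ({..<n} - X)" if "0 < s - a"
  proof -
    have "(s - a - 1) * r ^ a + a \<le> (s - a - 1) * r ^ a + a * r ^ a"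
      using \<open>r ^ a \<ge> 1\<close> by simp
    also have "\<dots> = (s - 1) * r ^ a"
      using that by (simp flip: add_mult_distrib)
    also have "\<dots> \<le> (t - 1) * r ^ a"
      using assms(2) by (intro mult_le_mono1 diff_le_mono)
    also note big
    finally show ?thesis
      using X by (simp add: card_Diff_subset)
  qed
  \<comment> \<open>The same pigeonhole with the sides exchanged: left vertices are now classified
    by their colours towards \<open>Y\<close>.\<close>
  then obtain Z where Z: "Z \<subseteq> {..<n} - X" "card Z = s - a"
    and col: "\<And>y z z'. y \<in> Y \<Longrightarrow> z \<in> Z \<Longrightarrow> z' \<in> Z \<Longrightarrow> d z y = d z' y"
    using pigeonhole_constant_vectors[of Y "{..<n} - X" "\<lambda>y x. d x y" r "s - a"] Y T(1) d
    by (auto simp: subset_iff)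
  then have "finite Z"
    using finite_subset by blast
  have "card (X \<union> Z) = s"
    using X Z \<open>finite Z\<close> assms(1) by (subst card_Un_disjoint) auto
  then have "q \<le> card ((\<lambda>(i, j). d i j) ` ((X \<union> Z) \<times> T))"
    using Hq_coloring_complete_bipartiteD[of "X \<union> Z" T q n n c] coloring X Z T
    unfolding d_def by auto
  also have "\<dots> \<le> card X + card Y + card Z * (card T - card Y)"
    using X(1) \<open>finite Z\<close> \<open>finite T\<close> Y(1) row col by (rule card_image_constant_strips)
  also have "\<dots> = 2 * a + (s - a) * (t - a)"
    using X Y Z T by simp
  finally show False
    using many by simp
qed

theorem theorem7p2:
  fixes s t a n :: nat
  assumes "2 \<le> a" and "a \<le> s" and "s \<le> t"
    and "a * (s + t - a - 2) \<ge> 1"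
    and "n \<ge> 1"
  shows "real (min_colors (complete_bipartite n n) (complete_bipartite s t)
                 (s * t - a * (s + t - a - 2) + 1))
         \<ge> (real n / (real t - 1)) powr (1 / real a)"
proof -
  let ?q = "s * t - a * (s + t - a - 2) + 1"
  define r where "r = min_colors (complete_bipartite n n) (complete_bipartite s t) ?q"
  have "\<exists>c :: (nat + nat) set \<Rightarrow> nat. c ` edges (complete_bipartite n n) \<subseteq> {..<r} \<and>
      Hq_coloring (complete_bipartite s t) ?q (complete_bipartite n n) c"
    unfolding r_def using is_graph_complete_bipartite color_number_admissible(3)[OF assms(1-4)]
    by (rule min_colors_attained)
  then obtain c :: "(nat + nat) set \<Rightarrow> nat"
    where c: "c ` edges (complete_bipartite n n) \<subseteq> {..<r}"
      "Hq_coloring (complete_bipartite s t) ?q (complete_bipartite n n) c"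
    by (elim exE conjE) (rule that)
  \<comment> \<open>Over the integers, \<open>2a + (s - a)(t - a) = st - a(s + t - a - 2)\<close>,
    which is exactly one less than the required number of colours.\<close>
  have "int (2 * a + (s - a) * (t - a)) = 2 * int a + (int s - int a) * (int t - int a)"
    using assms(2,3) by (simp add: of_nat_diff)
  also have "\<dots> < int ?q"
    unfolding color_number_admissible(1)[OF assms(1-4)] by (simp add: algebra_simps)
  finally have "2 * a + (s - a) * (t - a) < ?q"
    by (simp only: of_nat_less_iff)
  then have "n \<le> (t - 1) * r ^ a"
    using Hq_coloring_complete_bipartite_bound[OF assms(2,3,5) c] by simp
  then have "real n \<le> real ((t - 1) * r ^ a)"
    by (simp only: of_nat_le_iff)
  then have "real n \<le> (real t - 1) * real r ^ a"
    using assms(1-3) by (simp add: of_nat_diff)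
  then have "real n / (real t - 1) \<le> real r ^ a"
    using assms(1-3) by (simp add: divide_le_eq mult.commute)
  then have "(real n / (real t - 1)) powr (1 / real a) \<le> (real r ^ a) powr (1 / real a)"
    using assms(1-3) by (intro powr_mono2) auto
  \<comment> \<open>The case \<open>r = 0\<close> is separate because turning the power into
    \<open>powr\<close> requires a positive base.\<close>
  also have "\<dots> = real r"
    using assms(1) by (cases "r = 0") (simp_all add: powr_powr flip: powr_realpow)
  finally show ?thesis
    unfolding r_def .
qed

end
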